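(* For integers $r\ge1$ and $n\ge 0$ let $C_n^{(r)}=\frac{r}{2n+r}\binom{2n+r}{n}$. Then for every integer $k\ge 1$ $$\det\bigl(C_{i+j}^{(2k+1)}\bigr)_{i,j=0}^{k}=0.$$
   Context: The numbers $C_n^{(r)}$ are the convolution powers of the Catalan numbers $C_n=\frac1{n+1}\binom{2n}{n}$: $\sum_{n\ge0}C_n^{(r)}z^n=\bigl(\sum_{n\ge0}C_nz^n\bigr)^r$. The matrix in the claim has size $(k+1)\times(k+1)$. *)

theory Defs
  imports "Jordan_Normal_Form.Determinant"
begin

text \<open>The convolution powers of the Catalan numbers, by their closed form. They are indexed by
  r \<ge> 1 and n \<ge> 0; for r = 0 the closed form yields 0 (also at n = 0, where it reads 0 / 0),
  and that case carries no meaning. The values are integers, but the division is taken in the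
  rationals.\<close>

definition catalan_conv :: "nat \<Rightarrow> nat \<Rightarrow> rat" where
  "catalan_conv r n = of_nat r / of_nat (2 * n + r) * of_nat ((2 * n + r) choose n)"

end

theory Submission
  imports Defs
begin

text \<open>
  The closed form is a coefficient of a polynomial:
  \<open>C_n^{(r)} = [t^n] (1 - t) (1 + t)^{2n + r - 1}\<close>. Hence, for \<open>r = 2k + 1\<close> and any numbers
  \<open>v_0, \<dots>, v_k\<close>,
  \<open>\<Sum>_j v_j C_{i+j}^{(r)} = [t^{i+k}] (1 - t) (1 + t)^{2i+2k} P(t)\<close> with
  \<open>P(t) = \<Sum>_j v_j t^{k-j} (1 + t)^{2j}\<close>. The palindromic polynomial
  \<open>P = (1 + t^{2k+1}) / (1 + t)\<close> has this shape, as has any palindromic polynomial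
  of degree \<open>2k\<close>. For it the factor \<open>t^{2k+1}\<close> does not reach the
  coefficient of \<open>t^{i+k}\<close> when \<open>i \<le> k\<close>, and the remaining \<open>(1 - t) (1 + t)^{2(i+k)-1}\<close> is
  antisymmetric, so its middle coefficient is zero.
  Thus \<open>v\<close> is in the kernel of the matrix. (Up to sign, the \<open>v_j\<close> are the coefficients of a Lucas polynomial,
  but only their existence matters.)
\<close>

lemma coeff_one_minus_linear_mult:
  "coeff ([:1, -1:] * p) (Suc n) = coeff p (Suc n) - (coeff p n :: 'a :: comm_ring_1)"
  by (simp add: coeff_pCons)

text \<open>With M = 2n + r + 1, absorption gives n binom(M,n) = M binom(M-1,n-1). As r + 1 = M -
  2n, Pascal's rule turns the closed form into the ballot difference binom(M-1,n) -
  binom(M-1,n-1).\<close>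

lemma catalan_conv_eq_coeff:
  "catalan_conv (Suc r) n = coeff ([:1, -1:] * [:1, 1:] ^ (2 * n + r)) n"
proof (cases n)
  case 0
  then show ?thesis
    by (simp add: catalan_conv_def coeff_linear_poly_power coeff_mult)
next
  case (Suc m)
  define M where "M = 2 * n + Suc r"
  have "n * (M choose n) = M * (M - 1 choose (n - 1))"
    using times_binomial_minus1_eq[of n M] Suc by simp
  then have low: "of_nat n * of_nat (M choose n) = (of_nat M * of_nat (M - 1 choose (n - 1)) :: rat)"
    by (metis of_nat_mult)
  have "(M choose n) = (M - 1 choose (n - 1)) + (M - 1 choose n)"
    using Suc by (simp add: M_def)
  then have pascal: "of_nat (M choose n)
      = (of_nat (M - 1 choose (n - 1)) + of_nat (M - 1 choose n) :: rat)"
    by simp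
  have "(of_nat M :: rat) = 2 * of_nat n + of_nat (Suc r)"
    by (simp add: M_def)
  then have "of_nat (Suc r) * of_nat (M choose n)
      = (of_nat M * (of_nat (M - 1 choose n) - of_nat (M - 1 choose (n - 1))) :: rat)"
    using low pascal by (simp add: algebra_simps)
  moreover have "(of_nat M :: rat) \<noteq> 0"
    unfolding M_def of_nat_eq_0_iff by simp
  ultimately have "catalan_conv (Suc r) n
      = of_nat (M - 1 choose n) - of_nat (M - 1 choose (n - 1))"
    unfolding catalan_conv_def M_def[symmetric] by (simp add: divide_simps mult.commute)
  then show ?thesis
    unfolding Suc coeff_one_minus_linear_mult
    by (simp add: M_def Suc coeff_linear_poly_power del: binomial_Suc_Suc power_Suc)
qed

text \<open>The coefficient is the difference of the two equal central binomials in row 2m +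
  1.\<close>

lemma coeff_middle_antisymmetric:
  "coeff ([:1, -1:] * [:1, 1:] ^ Suc (2 * m) :: 'a :: comm_ring_1 poly) (Suc m) = 0"
  using binomial_symmetric[of m "Suc (2 * m)"]
  unfolding coeff_one_minus_linear_mult
  by (simp add: coeff_linear_poly_power del: binomial_Suc_Suc power_Suc)

text \<open>The generators t^(k-j) (1 + t)^(2j) are palindromic about degree k. The explicit range
  exposes the coefficients \<open>v\<close>, which later form the kernel vector.\<close>

definition palindromic_span :: "nat \<Rightarrow> 'a :: comm_ring_1 poly set" where
  "palindromic_span k =
     range (\<lambda>v. \<Sum>j\<le>k. smult (v j) (monom 1 (k - j) * [:1, 1:] ^ (2 * j)))"

lemma palindromic_spanI:
  "p = (\<Sum>j\<le>k. smult (v j) (monom 1 (k - j) * [:1, 1:] ^ (2 * j))) \<Longrightarrow> p \<in> palindromic_span k"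
  unfolding palindromic_span_def by (rule range_eqI)

lemma one_in_palindromic_span: "1 \<in> palindromic_span 0"
  by (rule palindromic_spanI[where v = "\<lambda>_. 1"]) simp

lemma palindromic_span_diff:
  assumes "p \<in> palindromic_span k" "q \<in> palindromic_span k"
  shows "p - q \<in> palindromic_span k"
proof -
  obtain v w where "p = (\<Sum>j\<le>k. smult (v j) (monom 1 (k - j) * [:1, 1:] ^ (2 * j)))"
    and "q = (\<Sum>j\<le>k. smult (w j) (monom 1 (k - j) * [:1, 1:] ^ (2 * j)))"
    using assms by (auto simp: palindromic_span_def)
  then have "p - q = (\<Sum>j\<le>k. smult (v j - w j) (monom 1 (k - j) * [:1, 1:] ^ (2 * j)))"
    by (simp add: smult_diff_left sum_subtractf)
  then show ?thesis
    by (rule palindromic_spanI)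
qed

text \<open>A factor t keeps j while k grows, so the new top generator gets coefficient 0.\<close>

lemma palindromic_span_monom_mult:
  assumes "p \<in> palindromic_span k"
  shows "monom c 1 * p \<in> palindromic_span (Suc k)"
proof -
  obtain v where p: "p = (\<Sum>j\<le>k. smult (v j) (monom 1 (k - j) * [:1, 1:] ^ (2 * j)))"
    using assms by (auto simp: palindromic_span_def)
  define w where "w j = (if j \<le> k then c * v j else 0)" for j
  have "monom c 1 * p = (\<Sum>j\<le>k. smult (w j) (monom 1 (Suc k - j) * [:1, 1:] ^ (2 * j)))"
    unfolding p sum_distrib_left
    by (intro sum.cong refl)
      (simp add: w_def Suc_diff_le mult_monom smult_monom flip: mult.assoc mult_smult_left)
  also have "\<dots> = (\<Sum>j\<le>Suc k. smult (w j) (monom 1 (Suc k - j) * [:1, 1:] ^ (2 * j)))"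
    by (simp add: w_def)
  finally show ?thesis
    by (rule palindromic_spanI)
qed

text \<open>A factor (1 + t)^2 raises j together with k, so the coefficients shift by one and j = 0
  gets 0.\<close>

lemma palindromic_span_square_mult:
  assumes "p \<in> palindromic_span k"
  shows "[:1, 1:] ^ 2 * p \<in> palindromic_span (Suc k)"
proof -
  obtain v where p: "p = (\<Sum>j\<le>k. smult (v j) (monom 1 (k - j) * [:1, 1:] ^ (2 * j)))"
    using assms by (auto simp: palindromic_span_def)
  define w where "w j = (if j = 0 then 0 else v (j - 1))" for j
  have "[:1, 1:] ^ 2 * p
      = (\<Sum>j\<le>k. smult (w (Suc j)) (monom 1 (Suc k - Suc j) * [:1, 1:] ^ (2 * Suc j)))"
    unfolding p sum_distrib_left
    by (intro sum.cong refl)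
      (simp add: w_def power2_eq_square ac_simps del: mult_pCons_left mult_pCons_right)
  also have "\<dots> = (\<Sum>j\<le>Suc k. smult (w j) (monom 1 (Suc k - j) * [:1, 1:] ^ (2 * j)))"
    unfolding sum.atMost_Suc_shift[of _ k] by (simp add: w_def)
  finally show ?thesis
    by (rule palindromic_spanI)
qed

text \<open>The witness is 1 - t + t^2 - ... + t^(2k). Since 1 + t^2 = (1 + t)^2 - 2t, its
  three-term recurrence needs only the closure properties above.\<close>

lemma alternating_in_palindromic_span:
  "\<exists>p \<in> palindromic_span k. [:1, 1:] * p = (1 + monom 1 (2 * k + 1) :: 'a :: comm_ring_1 poly)"
proof (induction k rule: induct_nat_012)
  case 0
  have "[:1, 1:] * 1 = (1 + monom 1 (2 * 0 + 1) :: 'a poly)"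
    by (simp add: monom_altdef one_pCons)
  then show ?case
    using one_in_palindromic_span by blast
next
  case 1
  \<comment> \<open>This is 1 - t + t^2 = (1 + t)^2 - 3t.\<close>
  have "[:1, 1:] ^ 2 * 1 - monom 3 1 * (1 :: 'a poly) \<in> palindromic_span (Suc 0)"
    by (intro palindromic_span_diff palindromic_span_square_mult palindromic_span_monom_mult
        one_in_palindromic_span)
  moreover have "[:1, 1:] * ([:1, 1:] ^ 2 * 1 - monom 3 1 * (1 :: 'a poly))
      = 1 + monom 1 (2 * Suc 0 + 1)"
    by (simp add: monom_altdef power2_eq_square numeral_3_eq_3 one_pCons)
  ultimately show ?case
    by blast
next
  case (ge2 k)
  obtain p q :: "'a poly" where p: "p \<in> palindromic_span k"
    and p_eq: "[:1, 1:] * p = 1 + monom 1 (2 * k + 1)"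
    and q: "q \<in> palindromic_span (Suc k)"
    and q_eq: "[:1, 1:] * q = 1 + monom 1 (2 * Suc k + 1)"
    using ge2 by blast
  define x where "x = (monom 1 1 :: 'a poly)"
  \<comment> \<open>the three-term recurrence \<open>P_{k+2} = (1 + t^2) P_{k+1} - t^2 P_k\<close>\<close>
  define s where "s = [:1, 1:] ^ 2 * q - monom 2 1 * q - x * (x * p)"
  have "s \<in> palindromic_span (Suc (Suc k))"
    unfolding s_def x_def
    by (intro palindromic_span_diff palindromic_span_square_mult palindromic_span_monom_mult p q)
  moreover have "[:1, 1:] * s = 1 + monom 1 (2 * Suc (Suc k) + 1)"
  proof -
    have lin: "[:1, 1:] = 1 + x" and two: "monom 2 1 = 2 * x"
      and mon: "monom 1 n = x ^ n" for n
      by (simp_all add: x_def monom_altdef one_pCons numeral_poly)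
    have "[:1, 1:] * s = (1 + x ^ 2) * ([:1, 1:] * q) - x ^ 2 * ([:1, 1:] * p)"
      unfolding s_def lin two by (simp add: algebra_simps power2_eq_square)
    \<comment> \<open>The cross terms t^2 and t^(2k+3) cancel.\<close>
    also have "\<dots> = 1 + monom 1 (2 * Suc (Suc k) + 1)"
      unfolding p_eq q_eq mon by (simp add: algebra_simps power2_eq_square)
    finally show ?thesis .
  qed
  ultimately show ?case
    by blast
qed

lemma catalan_conv_kernel:
  assumes "k \<ge> 1"
  shows "\<exists>v. (\<exists>j\<le>k. v j \<noteq> 0) \<and> (\<forall>i\<le>k. (\<Sum>j\<le>k. catalan_conv (2 * k + 1) (i + j) * v j) = 0)"
proof -
  obtain p v where p_eq: "[:1, 1:] * p = (1 + monom 1 (2 * k + 1) :: rat poly)"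
    and p: "p = (\<Sum>j\<le>k. smult (v j) (monom 1 (k - j) * [:1, 1:] ^ (2 * j)))"
    using alternating_in_palindromic_span[where 'a = rat and k = k]
    unfolding palindromic_span_def by blast
  \<comment> \<open>A nonzero constant term forces \<open>p\<close>, and hence some
    \<open>v j\<close>, to be nonzero.\<close>
  have "coeff ([:1, 1:] * p) 0 = 1"
    unfolding p_eq by simp
  then have "p \<noteq> 0"
    by auto
  then have "\<exists>j\<le>k. v j \<noteq> 0"
    unfolding p by (metis (no_types, lifting) atMost_iff smult_0_left sum.neutral)
  moreover have "(\<Sum>j\<le>k. catalan_conv (2 * k + 1) (i + j) * v j) = 0" if "i \<le> k" for i
  proof -
    \<comment> \<open>Now 2(i + k) = 2m + 2, so one factor 1 + t can be passed to \<open>p\<close>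
      and an odd power remains.\<close>
    obtain m where m: "i + k = Suc m"
      using assms by (cases "i + k") auto
    define Q where "Q = [:1, -1:] * ([:1, 1:] :: rat poly) ^ (2 * (i + k))"
    have term_eq: "catalan_conv (2 * k + 1) (i + j) * v j
        = coeff (Q * smult (v j) (monom 1 (k - j) * [:1, 1:] ^ (2 * j))) (i + k)"
      if "j \<le> k" for j
    proof -
      \<comment> \<open>The exponents 2(i + k) + 2j and 2(i + j) + 2k agree, and t^(k-j) moves
        degree i + j to i + k, so a whole row is read off at one degree.\<close>
      have "Q * smult (v j) (monom 1 (k - j) * [:1, 1:] ^ (2 * j))
          = smult (v j) (monom 1 (k - j) * ([:1, -1:] * [:1, 1:] ^ (2 * (i + j) + 2 * k)))"
        by (simp add: Q_def power_add algebra_simps del: mult_pCons_left mult_pCons_right)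
      moreover have "i + k - (k - j) = i + j" "k - j \<le> i + k"
        using that by auto
      ultimately show ?thesis
        using catalan_conv_eq_coeff[of "2 * k" "i + j"]
        by (simp add: coeff_monom_mult del: mult_pCons_left mult_pCons_right)
    qed
    have "(\<Sum>j\<le>k. catalan_conv (2 * k + 1) (i + j) * v j) = coeff (Q * p) (i + k)"
      unfolding p sum_distrib_left coeff_sum using term_eq by (intro sum.cong) auto
    also have "Q * p = [:1, -1:] * [:1, 1:] ^ Suc (2 * m) * ([:1, 1:] * p)"
      unfolding Q_def m by (simp add: ac_simps del: mult_pCons_left mult_pCons_right)
    also have "coeff \<dots> (i + k) = coeff ([:1, -1:] * [:1, 1:] ^ Suc (2 * m)) (i + k)"
      unfolding p_eq distrib_left mult.commute[of _ "monom _ _"] coeff_add coeff_monom_mult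
      using that by simp
    also have "\<dots> = 0"
      unfolding m by (rule coeff_middle_antisymmetric)
    finally show ?thesis .
  qed
  ultimately show ?thesis
    by blast
qed

theorem theorem7p1:
  fixes k :: nat
  assumes "k \<ge> 1"
  shows "det (mat (k + 1) (k + 1) (\<lambda>(i, j). catalan_conv (2 * k + 1) (i + j))) = 0"
proof -
  obtain v j where j: "j \<le> k" "v j \<noteq> 0"
    and ker: "\<And>i. i \<le> k \<Longrightarrow> (\<Sum>j\<le>k. catalan_conv (2 * k + 1) (i + j) * v j) = 0"
    using catalan_conv_kernel[OF assms] by blast
  let ?A = "mat (k + 1) (k + 1) (\<lambda>(i, j). catalan_conv (2 * k + 1) (i + j))"
  let ?v = "vec (k + 1) v"
  have "?v \<noteq> 0\<^sub>v (k + 1)"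
    using j by (metis index_vec index_zero_vec(1) less_Suc_eq_le Suc_eq_plus1)
  moreover have "?A *\<^sub>v ?v = 0\<^sub>v (k + 1)"
  proof (rule eq_vecI)
    fix i assume "i < dim_vec (0\<^sub>v (k + 1) :: rat vec)"
    then have "i \<le> k"
      by simp
    then have "(?A *\<^sub>v ?v) $ i = (\<Sum>j\<le>k. catalan_conv (2 * k + 1) (i + j) * v j)"
      by (auto simp: scalar_prod_def atLeast0LessThan lessThan_Suc_atMost intro!: sum.cong)
    then show "(?A *\<^sub>v ?v) $ i = 0\<^sub>v (k + 1) $ i"
      using ker[OF \<open>i \<le> k\<close>] \<open>i \<le> k\<close> by simp
  qed simp
  ultimately show ?thesis
    by (subst det_0_iff_vec_prod_zero[of _ "k + 1"]) (auto intro!: exI[of _ ?v])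
qed

end
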